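(* Let $a_{XY}$, where $X,Y\in\{\mathtt{L},\mathtt{S},\mathtt{W}\}$, be arbitrary positive integers (nine in total) and let $$n=\prod_{X,Y\in\{\mathtt{L},\mathtt{S},\mathtt{W}\}}a_{XY}+1.$$ Then every ordered $3$-uniform matching $M$ on $3n$ vertices either contains a semi-line of size $a_{\mathtt{LL}}+1$, or there exists $(X,Y)\neq(\mathtt{L},\mathtt{L})$ such that $M$ contains a sub-matching of $a_{XY}+1$ triples every two of which are in relation $\mathcal{R}_{XY}$.
   Context: An ordered $3$-uniform matching on $3n$ vertices is a family of $n$ pairwise disjoint $3$-element subsets (triples) of a linearly ordered set of $3n$ elements, say $\{1,\dots,3n\}$ (so every vertex is covered). The size of a matching is its number of triples; a sub-matching is a subfamily of its triples. Given two disjoint triples, let $A$ denote the one containing the smallest of the six vertices and $B$ the other one. Reading the six vertices in increasing order and writing the letter of the triple each belongs to yields a word of length $6$ with three $A$'s and three $B$'s, starting with $A$. There are ten such words, and they define the following relations between two triples: $\mathcal{R}_{\mathtt{LL}}$: $AAABBB$ (an alignment); $\mathcal{R}^*_{\mathtt{LL}}$: $AABABB$ (an engagement); $\mathcal{R}_{\mathtt{LS}}$: $AABBBA$; $\mathcal{R}_{\mathtt{LW}}$: $AABBAB$; $\mathcal{R}_{\mathtt{SL}}$: $ABBBAA$; $\mathcal{R}_{\mathtt{SS}}$: $ABBAAB$; $\mathcal{R}_{\mathtt{SW}}$: $ABBABA$; $\mathcal{R}_{\mathtt{WL}}$: $ABAABB$; $\mathcal{R}_{\mathtt{WS}}$: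 $ABABBA$; $\mathcal{R}_{\mathtt{WW}}$: $ABABAB$. A semi-line is an ordered $3$-uniform matching in which every pair of triples is in relation $\mathcal{R}_{\mathtt{LL}}$ or $\mathcal{R}^*_{\mathtt{LL}}$. A matching contains a semi-line if some sub-matching of it is a semi-line. *)

theory Defs
  imports Main
begin

(* Ordered 3-uniform matching with vertex set V; together with disjointness, the
   cardinality condition says that every vertex is covered. *)
definition ordered_matching :: "'a::linorder set \<Rightarrow> 'a set set \<Rightarrow> bool" where
  "ordered_matching V M \<longleftrightarrow>
     finite V \<and> card V = 3 * card M \<and>
     (\<forall>e\<in>M. e \<subseteq> V \<and> card e = 3) \<and> pairwise disjnt M"

datatype letter = A | B

(* Letter A always goes to the triple owning the smallest vertex of the union, so
   the word does not depend on the order in which two disjoint triples are given. *)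
definition pair_word :: "'a::linorder set \<Rightarrow> 'a set \<Rightarrow> letter list" where
  "pair_word e f =
     (let first = (if Min (e \<union> f) \<in> e then e else f)
      in map (\<lambda>v. if v \<in> first then A else B) (sorted_list_of_set (e \<union> f)))"

definition triples_form :: "letter list \<Rightarrow> 'a::linorder set \<Rightarrow> 'a set \<Rightarrow> bool" where
  "triples_form w e f \<longleftrightarrow> card e = 3 \<and> card f = 3 \<and> disjnt e f \<and> pair_word e f = w"

datatype style = L | S | W

fun style_word :: "style \<Rightarrow> style \<Rightarrow> letter list" where
  "style_word L L = [A,A,A,B,B,B]"
| "style_word L S = [A,A,B,B,B,A]"
| "style_word L W = [A,A,B,B,A,B]"
| "style_word S L = [A,B,B,B,A,A]"
| "style_word S S = [A,B,B,A,A,B]"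
| "style_word S W = [A,B,B,A,B,A]"
| "style_word W L = [A,B,A,A,B,B]"
| "style_word W S = [A,B,A,B,B,A]"
| "style_word W W = [A,B,A,B,A,B]"

definition R :: "style \<Rightarrow> style \<Rightarrow> 'a::linorder set \<Rightarrow> 'a set \<Rightarrow> bool" where
  "R X Y = triples_form (style_word X Y)"

definition engagement :: "'a::linorder set \<Rightarrow> 'a set \<Rightarrow> bool" where
  "engagement = triples_form [A,A,B,A,B,B]"

definition semi_line :: "'a::linorder set set \<Rightarrow> bool" where
  "semi_line N \<longleftrightarrow>
     ordered_matching (\<Union>N) N \<and> pairwise (\<lambda>e f. R L L e f \<or> engagement e f) N"

end

theory Submission
  imports Defs
begin

text \<open>
  Write a triple as \<open>x < y < z\<close>. Up to the choice between alignment and engagement, the relation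
  of two triples is determined by the relations of their pairs \<open>(x, y)\<close>, which gives the first
  style, and of their pairs \<open>(y, z)\<close>, which gives the second. For ordered graph matchings, being
  to the left and being nested are strict partial orders, and two edges incomparable in both cross;
  so Mirsky's theorem applied twice yields the three-style analogue of the claim. Applying this
  to the pairs \<open>(x, y)\<close>, and then to the pairs \<open>(y, z)\<close> within the sub-matching found, proves the
  theorem.
\<close>

section \<open>Strict partial orders and ordered graph matchings\<close>

text \<open>Mirsky's theorem for a strict partial order \<open>r\<close> on \<open>E\<close>, by
  induction on \<open>a\<close>. The minimal elements \<open>D\<close> form an antichain. If there
  are at most \<open>b\<close> of them, removing them leaves more than \<open>a * b\<close>
  elements, and a long chain found there can be lengthened by an element below its least
  one.\<close>

lemma chain_or_antichain:
  assumes "finite E" "transp_on E r" "asymp_on E r" "a * b < card E"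
  shows "(\<exists>C\<subseteq>E. a < card C \<and> pairwise (\<lambda>x y. r x y \<or> r y x) C) \<or>
         (\<exists>C\<subseteq>E. b < card C \<and> pairwise (\<lambda>x y. \<not> r x y \<and> \<not> r y x) C)"
  using assms
proof (induction a arbitrary: E)
  case 0
  then obtain x where "x \<in> E" by fastforce
  then show ?case
    by (intro disjI1 exI[of _ "{x}"]) auto
next
  case (Suc a)
  define D where "D = {x \<in> E. \<forall>y\<in>E. \<not> r y x}"
  show ?case
  proof (cases "b < card D")
    case True
    moreover have "pairwise (\<lambda>x y. \<not> r x y \<and> \<not> r y x) D" "D \<subseteq> E"
      by (auto simp: D_def pairwise_def)
    ultimately show ?thesis by blast
  next
    case False
    have D: "D \<subseteq> E" by (auto simp: D_def)
    then have "card (E - D) = card E - card D"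
      using \<open>finite E\<close> by (simp add: card_Diff_subset finite_subset)
    then have "a * b < card (E - D)"
      using False Suc.prems(4) by simp
    moreover have "transp_on (E - D) r" "asymp_on (E - D) r"
      using Suc.prems by (auto intro: transp_on_subset asymp_on_subset)
    ultimately consider
        (chain) C where "C \<subseteq> E - D" "a < card C" "pairwise (\<lambda>x y. r x y \<or> r y x) C"
      | (antichain) C where "C \<subseteq> E - D" "b < card C" "pairwise (\<lambda>x y. \<not> r x y \<and> \<not> r y x) C"
      using Suc.IH[of "E - D"] Suc.prems(1) by blast
    then show ?thesis
    proof cases
      case chain
      have fin: "finite C" and CE: "C \<subseteq> E"
        using chain(1) Suc.prems(1) by (auto intro: finite_subset)
      \<comment> \<open>As \<open>a < card C\<close>, the set \<open>C\<close> is nonempty and has a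
        minimal element; in a chain it lies below all the others.\<close>
      obtain c where c: "c \<in> C" "\<forall>x\<in>C. x \<noteq> c \<longrightarrow> \<not> r x c"
        using Finite_Set.bex_min_element[OF fin, of r] CE Suc.prems(2,3) chain(2)
        by (metis asymp_on_subset card.empty less_nat_zero_code transp_on_subset)
      \<comment> \<open>\<open>c\<close> lies outside \<open>D\<close>, so it is not minimal in
        \<open>E\<close>.\<close>
      obtain x where x: "x \<in> E" "r x c"
        using c(1) chain(1) by (auto simp: D_def)
      have below: "r x y" if "y \<in> C" for y
      proof (cases "y = c")
        case False
        then have "r c y" using c that chain(3) by (auto simp: pairwise_def)
        then show ?thesis
          using x c(1) that CE transp_onD[OF Suc.prems(2)] by blast
      qed (use x in simp)
      then have "x \<notin> C"
        using x(1) asymp_onD[OF Suc.prems(3)] by blast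
      then have "Suc a < card (insert x C)"
        using chain(2) fin by simp
      moreover have "pairwise (\<lambda>x y. r x y \<or> r y x) (insert x C)"
        using chain(3) below by (auto simp: pairwise_insert)
      ultimately show ?thesis
        using x(1) CE by (intro disjI1 exI[of _ "insert x C"]) auto
    next
      case antichain
      then show ?thesis by blast
    qed
  qed
qed

text \<open>Here \<open>p\<close> and \<open>q\<close> select the left and the right endpoint of an edge.\<close>

fun edges_form :: "style \<Rightarrow> ('b \<Rightarrow> 'a::linorder) \<Rightarrow> ('b \<Rightarrow> 'a) \<Rightarrow> 'b \<Rightarrow> 'b \<Rightarrow> bool" where
  "edges_form L p q e f \<longleftrightarrow> q e < p f \<or> q f < p e"
| "edges_form S p q e f \<longleftrightarrow> p e < p f \<and> q f < q e \<or> p f < p e \<and> q e < q f"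
| "edges_form W p q e f \<longleftrightarrow>
     p e < p f \<and> p f < q e \<and> q e < q f \<or> p f < p e \<and> p e < q f \<and> q f < q e"

lemma edges_form_commute: "edges_form X p q e f \<longleftrightarrow> edges_form X p q f e"
  by (cases X) auto

text \<open>Precedence is split off first, then nesting among the edges that remain. Edges have an
  arbitrary type \<open>'b\<close>, so that a triple can serve as an edge through any two of its
  vertices.\<close>

lemma graph_matching_style:
  fixes p q :: "'b \<Rightarrow> 'a::linorder"
  assumes fin: "finite E" and less: "\<And>e. e \<in> E \<Longrightarrow> p e < q e"
    and neq: "\<And>e f. e \<in> E \<Longrightarrow> f \<in> E \<Longrightarrow> e \<noteq> f \<Longrightarrow> p e \<noteq> p f \<and> p e \<noteq> q f \<and> q e \<noteq> q f"
    and card: "(\<Prod>X\<in>{L,S,W}. a X) < card E"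
  shows "\<exists>X. \<exists>F\<subseteq>E. a X < card F \<and> pairwise (edges_form X p q) F"
proof -
  have "transp_on E (\<lambda>e f. q e < p f)"
    by (rule transp_onI) (use less in \<open>metis less_trans\<close>)
  moreover have "asymp_on E (\<lambda>e f. q e < p f)"
    by (rule asymp_onI) (use less in \<open>metis less_trans less_asym\<close>)
  moreover have "a L * (a S * a W) < card E"
    using card by simp
  ultimately consider
      (line) F where "F \<subseteq> E" "a L < card F" "pairwise (\<lambda>e f. q e < p f \<or> q f < p e) F"
    | (rest) F where "F \<subseteq> E" "a S * a W < card F"
        "pairwise (\<lambda>e f. \<not> q e < p f \<and> \<not> q f < p e) F"
    using chain_or_antichain[OF fin] by meson
  then show ?thesis
  proof cases
    case line
    then show ?thesis
      by (intro exI[of _ L] exI[of _ F]) (auto simp: pairwise_def)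
  next
    case rest
    have "transp_on F (\<lambda>e f. p e < p f \<and> q f < q e)" "asymp_on F (\<lambda>e f. p e < p f \<and> q f < q e)"
      by (auto intro: transp_onI asymp_onI)
    moreover have "finite F"
      using rest(1) fin by (rule finite_subset)
    ultimately consider
        (stack) G where "G \<subseteq> F" "a S < card G"
          "pairwise (\<lambda>e f. p e < p f \<and> q f < q e \<or> p f < p e \<and> q e < q f) G"
      | (wave) G where "G \<subseteq> F" "a W < card G"
          "pairwise (\<lambda>e f. \<not> (p e < p f \<and> q f < q e) \<and> \<not> (p f < p e \<and> q e < q f)) G"
      using chain_or_antichain[OF _ _ _ rest(2)] by meson
    then show ?thesis
    proof cases
      case stack
      then show ?thesis
        using rest(1) by (intro exI[of _ S] exI[of _ G]) (auto simp: pairwise_def)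
    next
      case wave
      \<comment> \<open>With distinct endpoints, two edges that are not nested have left and right
        ends in the same order; as neither precedes the other, they overlap and therefore
        cross.\<close>
      have "pairwise (edges_form W p q) G"
      proof (rule pairwiseI)
        fix e f assume ef: "e \<in> G" "f \<in> G" "e \<noteq> f"
        then have E: "e \<in> E" "f \<in> E" using wave(1) rest(1) by auto
        have "\<not> q e < p f" "\<not> q f < p e"
          using rest(3) wave(1) ef by (auto simp: pairwise_def)
        moreover have "\<not> (p e < p f \<and> q f < q e)" "\<not> (p f < p e \<and> q e < q f)"
          using wave(3) ef by (auto simp: pairwise_def)
        moreover have "p e \<noteq> q f" "p f \<noteq> q e" "p e \<noteq> p f" "q e \<noteq> q f"
          using neq[OF E] neq[OF E(2,1)] ef(3) by auto
        ultimately show "edges_form W p q e f"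
          by (auto simp: not_less)
      qed
      then show ?thesis
        using wave rest(1) by blast
    qed
  qed
qed

section \<open>Ordered triples and the words of their pairs\<close>

lemma card_3_ordered:
  fixes e :: "'a::linorder set"
  assumes "card e = 3"
  shows "\<exists>x y z. x < y \<and> y < z \<and> e = {x, y, z}"
proof -
  obtain x y z where e: "e = {x, y, z}" "x \<noteq> y" "x \<noteq> z" "y \<noteq> z"
    using assms by (auto simp: card_3_iff)
  then consider "x < y \<and> y < z" | "x < z \<and> z < y" | "y < x \<and> x < z" | "y < z \<and> z < x"
    | "z < x \<and> x < y" | "z < y \<and> y < x"
    by (metis linorder_less_linear)
  then show ?thesis
    using e(1) by cases blast+
qed

text \<open>The head \<open>v\<close> is the smallest vertex and lies in \<open>e\<close>, so
  \<open>e\<close> receives the letter \<open>A\<close>; the word can then be read off an explicit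
  increasing list.\<close>

lemma pair_word_sorted:
  assumes "sorted_wrt (<) (v # vs)" "e \<union> f = set (v # vs)" "v \<in> e"
  shows "pair_word e f = map (\<lambda>u. if u \<in> e then A else B) (v # vs)"
proof -
  have "Min (e \<union> f) = v"
    using assms(1,2) by (intro Min_eqI) (auto intro: less_imp_le)
  moreover have "sorted_list_of_set (e \<union> f) = v # vs"
    unfolding assms(2) using assms(1)
    by (intro sorted_list_of_set.idem_if_sorted_distinct)
      (auto simp: strict_sorted_iff simp del: sorted_wrt.simps)
  ultimately show ?thesis
    using assms(3) by (simp add: pair_word_def Let_def)
qed

text \<open>By disjointness exactly one of the triples owns the smallest vertex, so
  \<open>first\<close> is the same triple in both orders.\<close>

lemma pair_word_commute:
  assumes "finite e" "finite f" "e \<noteq> {}" "disjnt e f"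
  shows "pair_word e f = pair_word f e"
proof -
  have "Min (e \<union> f) \<in> e \<union> f"
    using assms by (intro Min_in) auto
  then have "Min (e \<union> f) \<in> e \<longleftrightarrow> Min (f \<union> e) \<notin> f"
    using assms(4) by (auto simp: disjnt_def Un_commute)
  then show ?thesis
    by (simp add: pair_word_def Let_def Un_commute)
qed

lemma triples_form_commute: "triples_form w e f \<longleftrightarrow> triples_form w f e"
proof -
  have "pair_word e f = pair_word f e" if "card e = 3" "card f = 3" "disjnt e f"
  proof -
    have "finite e" "finite f" "e \<noteq> {}"
      using that card.infinite by force+
    then show ?thesis
      using pair_word_commute that(3) by blast
  qed
  then show ?thesis
    unfolding triples_form_def by (metis disjnt_sym)
qed

lemma triples_form_sorted:
  assumes "sorted_wrt (<) (v # vs)" "e \<union> f = set (v # vs)" "v \<in> e"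
    and "card e = 3" "card f = 3" "disjnt e f"
    and "map (\<lambda>u. if u \<in> e then A else B) (v # vs) = w"
  shows "triples_form w e f"
  using assms(4-) pair_word_sorted[OF assms(1-3)] by (simp add: triples_form_def)

section \<open>From styles of edges to relations of triples\<close>

text \<open>Engagement joins the case \<open>L\<close>, \<open>L\<close> because the relations of
  the two pairs do not decide whether the last vertex of one triple precedes the first vertex of the
  other.\<close>

definition style_form :: "style \<Rightarrow> style \<Rightarrow> 'a::linorder set \<Rightarrow> 'a set \<Rightarrow> bool" where
  "style_form X Y e f \<longleftrightarrow> R X Y e f \<or> (X, Y) = (L, L) \<and> engagement e f"

lemma style_form_commute: "style_form X Y e f \<longleftrightarrow> style_form X Y f e"
  using triples_form_commute by (auto simp: style_form_def R_def engagement_def)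

text \<open>Since \<open>p e < p f\<close>, the triple \<open>e\<close> carries the letter
  \<open>A\<close>. The two edge relations then fix the order of all six vertices, except that for
  \<open>L\<close>, \<open>L\<close> the order of \<open>r e\<close> and \<open>p f\<close> stays
  open.\<close>

lemma style_form_ordered:
  fixes p q r :: "'a::linorder set \<Rightarrow> 'a"
  assumes e: "e = {p e, q e, r e}" "p e < q e" "q e < r e"
    and f: "f = {p f, q f, r f}" "p f < q f" "q f < r f"
    and disj: "disjnt e f"
    and forms: "edges_form X p q e f" "edges_form Y q r e f"
    and less: "p e < p f"
  shows "style_form X Y e f"
proof -
  \<comment> \<open>Naming the vertices turns \<open>e(1)\<close> and \<open>f(1)\<close>, whose
    right sides mention \<open>e\<close> and \<open>f\<close> again, into equations safe for
    rewriting.\<close>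
  obtain x y z where xyz: "p e = x" "q e = y" "r e = z" by blast
  obtain u v w where uvw: "p f = u" "q f = v" "r f = w" by blast
  have sets: "e = {x, y, z}" "f = {u, v, w}"
    using e(1) f(1) unfolding xyz uvw by this+
  have ord: "x < y" "y < z" "u < v" "v < w" "x < u"
    using e(2,3) f(2,3) less unfolding xyz uvw by this+
  have card: "card e = 3" "card f = 3"
    unfolding sets card_3_iff using ord less_trans less_imp_neq by metis+
  have neq: "x \<noteq> u" "x \<noteq> v" "x \<noteq> w" "y \<noteq> u" "y \<noteq> v" "y \<noteq> w" "z \<noteq> u" "z \<noteq> v" "z \<noteq> w"
    using disj unfolding sets by auto
  \<comment> \<open>Each case now only has to supply the five vertices after \<open>x\<close> in
    increasing order.\<close>
  have *: "triples_form word e f"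
    if "sorted_wrt (<) (x # vs)" "set (x # vs) = {x, y, z, u, v, w}"
      "map (\<lambda>t. if t \<in> {x, y, z} then A else B) (x # vs) = word" for vs word
    using that card disj unfolding sets
    by (intro triples_form_sorted[of x vs]) auto
  note defs = style_form_def R_def engagement_def
  show ?thesis
  proof (cases X; cases Y)
    assume "X = L" "Y = L"
    moreover have "y < u" "z < v"
      using forms calculation ord xyz uvw by auto
    \<comment> \<open>The undecided comparison of \<open>z\<close> and \<open>u\<close> separates
      alignment from engagement.\<close>
    moreover have "triples_form (style_word L L) e f" if "z < u"
      by (rule *[of "[y,z,u,v,w]"]) (use that ord in auto)
    moreover have "triples_form [A,A,B,A,B,B] e f" if "\<not> z < u"
      by (rule *[of "[y,u,z,v,w]"]) (use that \<open>y < u\<close> \<open>z < v\<close> ord neq in auto)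
    ultimately show ?thesis by (auto simp: defs)
  next
    assume XY: "X = L" "Y = S"
    have "y < u" "w < z"
      using forms ord unfolding XY edges_form.simps xyz uvw by auto
    then have "triples_form (style_word L S) e f"
      by (intro *[of "[y,u,v,w,z]"]) (use ord in auto)
    then show ?thesis by (simp add: defs XY)
  next
    assume XY: "X = L" "Y = W"
    have "y < u" "v < z" "z < w"
      using forms ord unfolding XY edges_form.simps xyz uvw by auto
    then have "triples_form (style_word L W) e f"
      by (intro *[of "[y,u,v,z,w]"]) (use ord in auto)
    then show ?thesis by (simp add: defs XY)
  next
    assume XY: "X = S" "Y = L"
    have "w < y"
      using forms ord unfolding XY edges_form.simps xyz uvw by auto
    then have "triples_form (style_word S L) e f"
      by (intro *[of "[u,v,w,y,z]"]) (use ord in auto)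
    then show ?thesis by (simp add: defs XY)
  next
    assume XY: "X = S" "Y = S"
    have "v < y" "z < w"
      using forms ord unfolding XY edges_form.simps xyz uvw by auto
    then have "triples_form (style_word S S) e f"
      by (intro *[of "[u,v,y,z,w]"]) (use ord in auto)
    then show ?thesis by (simp add: defs XY)
  next
    assume XY: "X = S" "Y = W"
    have "v < y" "y < w" "w < z"
      using forms ord unfolding XY edges_form.simps xyz uvw by auto
    then have "triples_form (style_word S W) e f"
      by (intro *[of "[u,v,y,w,z]"]) (use ord in auto)
    then show ?thesis by (simp add: defs XY)
  next
    assume XY: "X = W" "Y = L"
    have "u < y" "z < v"
      using forms ord unfolding XY edges_form.simps xyz uvw by auto
    then have "triples_form (style_word W L) e f"
      by (intro *[of "[u,y,z,v,w]"]) (use ord in auto)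
    then show ?thesis by (simp add: defs XY)
  next
    assume XY: "X = W" "Y = S"
    have "u < y" "y < v" "w < z"
      using forms ord unfolding XY edges_form.simps xyz uvw by auto
    then have "triples_form (style_word W S) e f"
      by (intro *[of "[u,y,v,w,z]"]) (use ord in auto)
    then show ?thesis by (simp add: defs XY)
  next
    assume XY: "X = W" "Y = W"
    have "u < y" "y < v" "v < z" "z < w"
      using forms ord unfolding XY edges_form.simps xyz uvw by auto
    then have "triples_form (style_word W W) e f"
      by (intro *[of "[u,y,v,z,w]"]) (use ord in auto)
    then show ?thesis by (simp add: defs XY)
  qed
qed

text \<open>Needed because a semi-line must itself be a matching that covers its own union;
  disjointness makes the vertex count exact.\<close>

lemma ordered_matching_subset:
  assumes "ordered_matching V M" "N \<subseteq> M"
  shows "ordered_matching (\<Union>N) N"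
proof -
  have N: "\<And>e. e \<in> N \<Longrightarrow> card e = 3" "pairwise disjnt N" "\<Union>N \<subseteq> V" "finite V"
    using assms by (auto simp: ordered_matching_def intro: pairwise_subset)
  have "card (\<Union>N) = (\<Sum>e\<in>N. card e)"
    using N(2-) by (intro card_Union_disjoint) (auto intro: finite_subset)
  also have "\<dots> = 3 * card N"
    using N(1) by simp
  finally show ?thesis
    using N by (auto simp: ordered_matching_def intro: finite_subset)
qed

section \<open>The two successive selections\<close>

theorem theorem5:
  fixes a :: "style \<Rightarrow> style \<Rightarrow> nat"
    and n :: nat
    and V :: "'a::linorder set"
    and M :: "'a set set"
  assumes "\<And>X Y. a X Y > 0"
    and "n = (\<Prod>X\<in>{L,S,W}. \<Prod>Y\<in>{L,S,W}. a X Y) + 1"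
    and "ordered_matching V M"
    and "card V = 3 * n"
  shows "(\<exists>N\<subseteq>M. semi_line N \<and> card N = a L L + 1) \<or>
         (\<exists>X Y. (X, Y) \<noteq> (L, L) \<and>
            (\<exists>N\<subseteq>M. card N = a X Y + 1 \<and> pairwise (R X Y) N))"
proof -
  have M: "card M = n" "\<And>e. e \<in> M \<Longrightarrow> card e = 3" "pairwise disjnt M"
    using assms(3,4) by (auto simp: ordered_matching_def)
  \<comment> \<open>An infinite \<open>M\<close> would have cardinality 0, but \<open>n\<close> is
    positive.\<close>
  then have "finite M"
    using assms(2) by (intro card_ge_0_finite) simp
  have "\<forall>e\<in>M. \<exists>x y z. x < y \<and> y < z \<and> e = {x, y, z}"
    using M(2) card_3_ordered by blast
  then obtain p q r where pqr: "\<And>e. e \<in> M \<Longrightarrow> p e < q e \<and> q e < r e \<and> e = {p e, q e, r e}"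
    by metis
  have disj: "disjnt e f" if "e \<in> M" "f \<in> M" "e \<noteq> f" for e f
    using M(3) that by (auto simp: pairwise_def)
  have neq: "p e \<noteq> p f \<and> p e \<noteq> q f \<and> q e \<noteq> q f \<and> q e \<noteq> r f \<and> r e \<noteq> r f"
    if "e \<in> M" "f \<in> M" "e \<noteq> f" for e f
    using disj[OF that] pqr[OF that(1)] pqr[OF that(2)]
    by (metis disjnt_iff insertCI)
  have "(\<Prod>X\<in>{L,S,W}. \<Prod>Y\<in>{L,S,W}. a X Y) < card M"
    using M(1) assms(2) by simp
  \<comment> \<open>The threshold for a first style \<open>X\<close> is the product of the
    \<open>a X Y\<close> over all \<open>Y\<close>, exactly what the second selection inside
    \<open>F\<close> requires.\<close>
  then obtain X F where F: "F \<subseteq> M" "(\<Prod>Y\<in>{L,S,W}. a X Y) < card F" "pairwise (edges_form X p q) F"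
    using graph_matching_style[OF \<open>finite M\<close>, of p q "\<lambda>X. \<Prod>Y\<in>{L,S,W}. a X Y"] pqr neq by blast
  moreover have "finite F"
    using F(1) \<open>finite M\<close> by (rule finite_subset)
  ultimately obtain Y G where G: "G \<subseteq> F" "a X Y < card G" "pairwise (edges_form Y q r) G"
    using graph_matching_style[of F q r "a X"] pqr neq by (metis subsetD)
  \<comment> \<open>Trimming gives the exact size demanded; pairwise relations pass to
    subsets.\<close>
  obtain N where N: "N \<subseteq> G" "card N = a X Y + 1"
    using obtain_subset_with_card_n[of "a X Y + 1" G] G(2) by auto
  have NM: "N \<subseteq> M"
    using N(1) G(1) F(1) by simp
  have "pairwise (style_form X Y) N"
  proof (rule pairwiseI)
    fix e f assume ef: "e \<in> N" "f \<in> N" "e \<noteq> f"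
    then have in_M: "e \<in> M" "f \<in> M" using NM by auto
    have forms: "edges_form X p q e f" "edges_form Y q r e f"
      using ef N(1) G(1) pairwiseD[OF F(3)] pairwiseD[OF G(3)] by blast+
    \<comment> \<open>By symmetry the triple with the smaller first vertex may be taken as the one
      lettered \<open>A\<close>.\<close>
    consider "p e < p f" | "p f < p e"
      using neq[OF in_M ef(3)] by fastforce
    then show "style_form X Y e f"
    proof cases
      case 1
      then show ?thesis
        using style_form_ordered[of e p q r f] pqr[OF in_M(1)] pqr[OF in_M(2)]
          disj[OF in_M ef(3)] forms by blast
    next
      case 2
      then have "style_form X Y f e"
        using style_form_ordered[of f p q r e] pqr[OF in_M(1)] pqr[OF in_M(2)]
          disj[OF in_M(2,1)] ef(3) forms[THEN edges_form_commute[THEN iffD1]] by blast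
      then show ?thesis by (simp add: style_form_commute)
    qed
  qed
  then have style: "pairwise (\<lambda>e f. R X Y e f \<or> (X, Y) = (L, L) \<and> engagement e f) N"
    by (simp add: pairwise_def style_form_def)
  show ?thesis
  proof (cases "(X, Y) = (L, L)")
    case True
    then have "semi_line N" "card N = a L L + 1"
      using style N(2) ordered_matching_subset[OF assms(3) NM] by (simp_all add: semi_line_def)
    then show ?thesis using NM by blast
  next
    case False
    then have "pairwise (R X Y) N"
      using style unfolding pairwise_def by blast
    then show ?thesis using False N(2) NM by blast
  qed
qed

end
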